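(* Let $\beta^{(3)}=\{\beta_{ij}\}_{i,j\ge 0,\ i+j\le 3}$ be a nonsingular cubic binary moment sequence, let $a_0,a_1,a_2,a_3$ be the cubic moments of its normalization, and let $$k:=(1+a_0a_2+a_1a_3)-(a_1^2+a_2^2).$$ Assume that $k=0$. Then $\beta^{(3)}$ admits a $3$-atomic representing measure; that is, there exist three distinct points $(x_1,y_1),(x_2,y_2),(x_3,y_3)\in\mathbb{R}^2$ and real numbers $\rho_1,\rho_2,\rho_3>0$ such that $\beta_{ij}=\sum_{l=1}^{3}\rho_l\,x_l^i y_l^j$ for all integers $i,j\ge 0$ with $i+j\le 3$.
   Context: A cubic binary (real) moment sequence is a finite family of real numbers $\beta^{(3)}=\{\beta_{00},\beta_{10},\beta_{01},\beta_{20},\beta_{11},\beta_{02},\beta_{30},\beta_{21},\beta_{12},\beta_{03}\}$ with $\beta_{00}>0$ (no measure is assumed to exist). It is called nonsingular if the $3\times 3$ matrix $$\mathcal{M}(1)=\begin{pmatrix}\beta_{00}&\beta_{10}&\beta_{01}\\ \beta_{10}&\beta_{20}&\beta_{11}\\ \beta_{01}&\beta_{11}&\beta_{02}\end{pmatrix}$$ is positive definite. A representing measure for $\beta^{(3)}$ is a positive Borel measure $\mu$ on $\mathbb{R}^2$ such that $\beta_{ij}=\int x^iy^j\,d\mu$ for all $i,j\ge 0$ with $i+j\le 3$. It is $r$-atomic if its support consists of exactly $r$ points. Normalization: first, dividing all $\beta_{ij}$ by $\beta_{00}$, assume $\beta_{00}=1$. Put $d_2:=\beta_{20}-\beta_{10}^2$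 and $d_3:=\det\mathcal{M}(1)=-\beta_{02}\beta_{10}^2+2\beta_{01}\beta_{10}\beta_{11}-\beta_{11}^2-\beta_{01}^2\beta_{20}+\beta_{02}\beta_{20}$, both strictly positive by nonsingularity. Let $$\Psi_1(x,y):=\frac{\beta_{01}\beta_{20}-\beta_{10}\beta_{11}}{\sqrt{d_2d_3}}+\frac{\beta_{11}-\beta_{01}\beta_{10}}{\sqrt{d_2d_3}}\,x-\sqrt{\frac{d_2}{d_3}}\,y,\qquad \Psi_2(x,y):=-\frac{\beta_{10}}{\sqrt{d_2}}+\frac{1}{\sqrt{d_2}}\,x .$$ Let $\Lambda_\beta$ be the Riesz functional, i.e. the linear functional on real polynomials in $x,y$ of degree at most $3$ with $\Lambda_\beta(x^iy^j)=\beta_{ij}$, and define $\tilde\beta_{ij}:=\Lambda_\beta(\Psi_1^i\Psi_2^j)$ for $i+j\le 3$. Then $\tilde\beta_{00}=\tilde\beta_{20}=\tilde\beta_{02}=1$ and $\tilde\beta_{10}=\tilde\beta_{01}=\tilde\beta_{11}=0$, so that $\tilde\beta=\{1,0,0,1,0,1,a_0,a_1,a_2,a_3\}$ where $a_i:=\tilde\beta_{3-i,i}$ for $i=0,1,2,3$. The sequence $\tilde\beta$ is the normalization of $\beta^{(3)}$, and $a_0,\dots,a_3$ are its cubic moments. *)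

theory Defs
  imports "HOL-Analysis.Analysis" "HOL-Computational_Algebra.Polynomial"
begin

text \<open>
  A cubic binary sequence is a function \<open>\<beta> :: nat \<Rightarrow> nat \<Rightarrow> real\<close> of which only the values
  \<open>\<beta> i j\<close> with \<open>i + j \<le> 3\<close> are ever used.
\<close>

definition moment_matrix :: "(nat \<Rightarrow> nat \<Rightarrow> real) \<Rightarrow> real^3^3" where
  "moment_matrix \<beta> = vector
     [vector [\<beta> 0 0, \<beta> 1 0, \<beta> 0 1],
      vector [\<beta> 1 0, \<beta> 2 0, \<beta> 1 1],
      vector [\<beta> 0 1, \<beta> 1 1, \<beta> 0 2]]"

definition positive_definite :: "real^'n^'n \<Rightarrow> bool" where
  "positive_definite A \<longleftrightarrow> transpose A = A \<and> (\<forall>v. v \<noteq> 0 \<longrightarrow> v \<bullet> (A *v v) > 0)"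

definition nonsingular_cubic :: "(nat \<Rightarrow> nat \<Rightarrow> real) \<Rightarrow> bool" where
  "nonsingular_cubic \<beta> \<longleftrightarrow> positive_definite (moment_matrix \<beta>)"

definition representing_measure ::
  "(nat \<Rightarrow> nat \<Rightarrow> real) \<Rightarrow> (real \<times> real) measure \<Rightarrow> bool" where
  "representing_measure \<beta> \<mu> \<longleftrightarrow> sets \<mu> = sets borel \<and>
     (\<forall>i j. i + j \<le> 3 \<longrightarrow> has_bochner_integral \<mu> (\<lambda>(x, y). x ^ i * y ^ j) (\<beta> i j))"

definition measure_support :: "'a::topological_space measure \<Rightarrow> 'a set" where
  "measure_support \<mu> = {p. \<forall>U. open U \<longrightarrow> p \<in> U \<longrightarrow> emeasure \<mu> U > 0}"

definition atomic_measure :: "nat \<Rightarrow> 'a::topological_space measure \<Rightarrow> bool" where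
  "atomic_measure r \<mu> \<longleftrightarrow> finite (measure_support \<mu>) \<and> card (measure_support \<mu>) = r"

text \<open>
  A polynomial in \<open>x\<close> and \<open>y\<close> is a polynomial in \<open>y\<close> whose coefficients are polynomials in \<open>x\<close>;
  thus the coefficient of \<open>x ^ i * y ^ j\<close> in \<open>p\<close> is \<open>coeff (coeff p j) i\<close>.
  The Riesz functional is meant for total degree at most 3; monomials of higher degree are ignored.
\<close>

definition riesz :: "(nat \<Rightarrow> nat \<Rightarrow> real) \<Rightarrow> real poly poly \<Rightarrow> real" where
  "riesz \<beta> p = (\<Sum>(i, j) \<in> {(i, j). i + j \<le> 3}. \<beta> i j * coeff (coeff p j) i)"

definition d2 :: "(nat \<Rightarrow> nat \<Rightarrow> real) \<Rightarrow> real" where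
  "d2 \<beta> = \<beta> 2 0 - (\<beta> 1 0)\<^sup>2"

definition d3 :: "(nat \<Rightarrow> nat \<Rightarrow> real) \<Rightarrow> real" where
  "d3 \<beta> = det (moment_matrix \<beta>)"

definition Psi1 :: "(nat \<Rightarrow> nat \<Rightarrow> real) \<Rightarrow> real poly poly" where
  "Psi1 \<beta> =
     [:[:(\<beta> 0 1 * \<beta> 2 0 - \<beta> 1 0 * \<beta> 1 1) / sqrt (d2 \<beta> * d3 \<beta>),
         (\<beta> 1 1 - \<beta> 0 1 * \<beta> 1 0) / sqrt (d2 \<beta> * d3 \<beta>):],
       [:- sqrt (d2 \<beta> / d3 \<beta>):]:]"

definition Psi2 :: "(nat \<Rightarrow> nat \<Rightarrow> real) \<Rightarrow> real poly poly" where
  "Psi2 \<beta> = [:[:- (\<beta> 1 0 / sqrt (d2 \<beta>)), 1 / sqrt (d2 \<beta>):]:]"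

text \<open>
  \<open>d2\<close>, \<open>d3\<close>, \<open>Psi1\<close> and \<open>Psi2\<close> presuppose \<open>\<beta> 0 0 = 1\<close>, which the initial scaling below ensures.
\<close>

definition scaled :: "(nat \<Rightarrow> nat \<Rightarrow> real) \<Rightarrow> nat \<Rightarrow> nat \<Rightarrow> real" where
  "scaled \<beta> i j = \<beta> i j / \<beta> 0 0"

definition normalization :: "(nat \<Rightarrow> nat \<Rightarrow> real) \<Rightarrow> nat \<Rightarrow> nat \<Rightarrow> real" where
  "normalization \<beta> i j = riesz (scaled \<beta>) (Psi1 (scaled \<beta>) ^ i * Psi2 (scaled \<beta>) ^ j)"

definition cubic_moment :: "(nat \<Rightarrow> nat \<Rightarrow> real) \<Rightarrow> nat \<Rightarrow> real" where
  "cubic_moment \<beta> i = normalization \<beta> (3 - i) i"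

end

theory Submission
  imports Defs
begin

text \<open>
  For the normalized sequence, \<open>1, x, y\<close> is orthonormal for \<open>\<langle>p, q\<rangle> = \<Lambda>(p q)\<close>, and the
  compressions of multiplication by \<open>x\<close> and \<open>y\<close> to linear polynomials are symmetric operators;
  they commute exactly when \<open>k = 0\<close>. Their joint eigenvalues, weighted by the squared
  components of \<open>1\<close> along the joint eigenvectors, are the three atoms: the operators send \<open>1\<close> to
  \<open>x\<close> and \<open>y\<close>, so every eigenvector is a multiple of \<open>(1, \<lambda>, \<mu>)\<close>, which
  makes all weights positive and the atoms distinct. The affine change of variables
  \<open>(\<Psi>\<^sub>1, \<Psi>\<^sub>2)\<close> transports the atoms back.
\<close>

section \<open>Simultaneous diagonalization of commuting symmetric operators\<close>

text \<open>A maximizer of the Rayleigh quotient on the unit sphere of \<open>S\<close> is an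
  eigenvector: its residual lies in \<open>S\<close> by invariance, and moving along it would raise
  the quotient unless it vanishes.\<close>

lemma selfadjoint_eigenvector_in_subspace:
  fixes f :: "'a::euclidean_space \<Rightarrow> 'a"
  assumes f: "linear f" and adj: "\<And>x y. f x \<bullet> y = x \<bullet> f y"
    and S: "subspace S" "S \<noteq> {0}" and inv: "f ` S \<subseteq> S"
  obtains v c where "v \<in> S" "v \<noteq> 0" "f v = c *\<^sub>R v"
proof -
  define K where "K = S \<inter> sphere 0 1"
  obtain x where x: "x \<in> S" "x \<noteq> 0" using S subspace_0 by blast
  then have "x /\<^sub>R norm x \<in> K"
    using S(1) by (simp add: K_def subspace_scale)
  moreover have "compact K"
    unfolding K_def using closed_subspace[OF S(1)] by (simp add: closed_Int_compact)
  moreover have "continuous_on K (\<lambda>v. f v \<bullet> v)"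
    by (intro continuous_intros linear_continuous_on linear_conv_bounded_linear[THEN iffD1] f)
  ultimately have "\<exists>v\<in>K. \<forall>w\<in>K. f w \<bullet> w \<le> f v \<bullet> v"
    by (intro continuous_attains_sup) auto
  then obtain v where v: "v \<in> K" and max: "\<And>w. w \<in> K \<Longrightarrow> f w \<bullet> w \<le> f v \<bullet> v" by blast
  define c where "c = f v \<bullet> v"
  have vS: "v \<in> S" and nv: "v \<bullet> v = 1" using v by (auto simp: K_def norm_eq_1)
  have bound: "f w \<bullet> w \<le> c * (w \<bullet> w)" if "w \<in> S" for w
  proof (cases "w = 0")
    case True
    then show ?thesis using linear_0[OF f] by simp
  next
    case False
    then have "w /\<^sub>R norm w \<in> K" using that S(1) by (simp add: K_def subspace_scale)
    from max[OF this] have "(f w \<bullet> w) / (norm w)\<^sup>2 \<le> c"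
      by (simp add: c_def linear_scale[OF f] power2_eq_square divide_simps)
    then show ?thesis using False by (simp add: divide_simps dot_square_norm)
  qed
  define r where "r = c *\<^sub>R v - f v"
  have rS: "r \<in> S" unfolding r_def using S(1) vS inv by (auto intro!: subspace_diff subspace_scale)
  define g where "g = c * (r \<bullet> r) - f r \<bullet> r"
  \<comment> \<open>First-order optimality at \<open>v\<close> in the direction of the residual \<open>r\<close>.\<close>
  have quad: "0 \<le> 2 * t * (r \<bullet> r) + t\<^sup>2 * g" for t
  proof -
    have "v + t *\<^sub>R r \<in> S" using S(1) vS rS by (simp add: subspace_add subspace_scale)
    from bound[OF this]
    have "0 \<le> c * ((v + t *\<^sub>R r) \<bullet> (v + t *\<^sub>R r)) - f (v + t *\<^sub>R r) \<bullet> (v + t *\<^sub>R r)" by simp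
    also have "\<dots> = c * (v \<bullet> v) - f v \<bullet> v + t * (2 * (c *\<^sub>R v \<bullet> r) - f v \<bullet> r - f r \<bullet> v) + t\<^sup>2 * g"
      by (simp add: linear_add[OF f] linear_scale[OF f] g_def algebra_simps inner_commute
          power2_eq_square)
    also have "f r \<bullet> v = f v \<bullet> r" using adj[of v r] by (simp add: inner_commute)
    finally show ?thesis by (simp add: nv c_def[symmetric]) (simp add: r_def algebra_simps)
  qed
  have "r \<bullet> r = 0"
  proof (rule ccontr)
    assume "r \<bullet> r \<noteq> 0"
    then have pos: "r \<bullet> r > 0" by simp
    \<comment> \<open>For a small negative t the linear term of \<open>quad\<close> dominates; t =
      -(r . r)/h is small enough because g < h.\<close>
    define h where "h = \<bar>g\<bar> + 1"
    have h: "h > 0" "g < h" by (auto simp: h_def)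
    have "2 * (- (r \<bullet> r) / h) * (r \<bullet> r) + (- (r \<bullet> r) / h)\<^sup>2 * g
        = (r \<bullet> r)\<^sup>2 / h * (g / h - 2)"
      using h by (simp add: field_simps power2_eq_square)
    also have "\<dots> < 0" using h pos by (intro mult_pos_neg) (auto simp: field_simps)
    finally show False using quad[of "- (r \<bullet> r) / h"] by simp
  qed
  then have "f v = c *\<^sub>R v" by (simp add: r_def)
  moreover have "v \<noteq> 0" using nv by auto
  ultimately show ?thesis using vS that by blast
qed

text \<open>Commutation makes each eigenspace of \<open>f\<close> inside \<open>S\<close> invariant
  under \<open>g\<close>, so the previous lemma, applied to \<open>g\<close> there, finds a joint
  eigenvector.\<close>

lemma commuting_selfadjoint_eigenvector_in_subspace:
  fixes f g :: "'a::euclidean_space \<Rightarrow> 'a"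
  assumes f: "linear f" "\<And>x y. f x \<bullet> y = x \<bullet> f y"
    and g: "linear g" "\<And>x y. g x \<bullet> y = x \<bullet> g y"
    and comm: "\<And>x. f (g x) = g (f x)"
    and S: "subspace S" "S \<noteq> {0}" "f ` S \<subseteq> S" "g ` S \<subseteq> S"
  obtains v c d where "v \<in> S" "v \<noteq> 0" "f v = c *\<^sub>R v" "g v = d *\<^sub>R v"
proof -
  obtain u c where u: "u \<in> S" "u \<noteq> 0" "f u = c *\<^sub>R u"
    using selfadjoint_eigenvector_in_subspace[OF f S(1-3)] .
  define E where "E = {x \<in> S. f x = c *\<^sub>R x}"
  have E: "subspace E"
    using S(1) unfolding E_def subspace_def
    by (auto simp: linear_0[OF f(1)] linear_add[OF f(1)] linear_scale[OF f(1)] algebra_simps)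
  have "E \<noteq> {0}" using u by (auto simp: E_def)
  moreover have "g ` E \<subseteq> E"
    using S(4) by (auto simp: E_def comm linear_scale[OF g(1)])
  ultimately obtain v d where "v \<in> E" "v \<noteq> 0" "g v = d *\<^sub>R v"
    using selfadjoint_eigenvector_in_subspace[OF g E] by blast
  then show ?thesis using that by (auto simp: E_def)
qed

text \<open>Take an orthonormal set of joint eigenvectors of greatest cardinality. If it did not
  span, its orthogonal complement, invariant by self-adjointness, would contain one more.\<close>

lemma commuting_selfadjoint_orthonormal_basis:
  fixes f g :: "'a::euclidean_space \<Rightarrow> 'a"
  assumes f: "linear f" "\<And>x y. f x \<bullet> y = x \<bullet> f y"
    and g: "linear g" "\<And>x y. g x \<bullet> y = x \<bullet> g y"
    and comm: "\<And>x. f (g x) = g (f x)"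
  obtains B l m where "finite B" "card B = DIM('a)" "span B = UNIV" "pairwise orthogonal B"
    "\<And>b. b \<in> B \<Longrightarrow> norm b = 1"
    "\<And>b. b \<in> B \<Longrightarrow> f b = l b *\<^sub>R b" "\<And>b. b \<in> B \<Longrightarrow> g b = m b *\<^sub>R b"
proof -
  define P where "P B \<longleftrightarrow> finite B \<and> pairwise orthogonal B \<and>
    (\<forall>b\<in>B. norm b = 1 \<and> (\<exists>c. f b = c *\<^sub>R b) \<and> (\<exists>d. g b = d *\<^sub>R b))" for B
  have ind: "independent B" if "P B" for B
    using that by (intro pairwise_orthogonal_independent) (auto simp: P_def)
  have bound: "card B \<le> DIM('a)" if "P B" for B
    using independent_bound[OF ind[OF that]] by simp
  have "P {}" by (simp add: P_def)
  moreover have "\<forall>C. P C \<longrightarrow> card C < Suc (DIM('a))" using bound by (simp add: less_Suc_eq_le)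
  ultimately have "\<exists>B. P B \<and> (\<forall>C. P C \<longrightarrow> card C \<le> card B)"
    by (rule ex_has_greatest_nat)
  then obtain B where B: "P B" and maxB: "\<And>C. P C \<Longrightarrow> card C \<le> card B" by blast
  have "span B = UNIV"
  proof (rule ccontr)
    assume "span B \<noteq> UNIV"
    then have lt: "dim B < DIM('a)"
      using dim_eq_full[of B] dim_subset_UNIV[of B] by simp
    define S where "S = {x. \<forall>b\<in>B. orthogonal b x}"
    obtain x where "x \<noteq> 0" "\<And>y. y \<in> span B \<Longrightarrow> orthogonal x y"
      using orthogonal_to_subspace_exists[OF lt] by blast
    then have "S \<noteq> {0}"
      by (auto simp: S_def orthogonal_commute span_base)
    moreover have "subspace S"
      unfolding S_def by (simp add: subspace_orthogonal_to_vectors)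
    moreover have "f ` S \<subseteq> S"
      using B by (auto simp: S_def orthogonal_def P_def f(2)[symmetric])
    moreover have "g ` S \<subseteq> S"
      using B by (auto simp: S_def orthogonal_def P_def g(2)[symmetric])
    ultimately obtain v c d where v: "v \<in> S" "v \<noteq> 0" "f v = c *\<^sub>R v" "g v = d *\<^sub>R v"
      using commuting_selfadjoint_eigenvector_in_subspace[OF f g comm] by metis
    define w where "w = v /\<^sub>R norm v"
    have wS: "orthogonal b w" if "b \<in> B" for b
      using v that by (simp add: w_def S_def orthogonal_def)
    have nw: "norm w = 1" using v by (simp add: w_def)
    have "f w = c *\<^sub>R w" "g w = d *\<^sub>R w"
      using v by (simp_all add: w_def linear_scale[OF f(1)] linear_scale[OF g(1)])
    with B wS nw have "P (insert w B)"
      by (auto simp: P_def pairwise_insert orthogonal_commute)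
    from maxB[OF this] B have "w \<in> B"
      by (cases "w \<in> B") (auto simp: P_def)
    with wS[of w] nw show False by (auto simp: orthogonal_def)
  qed
  moreover from this have "card B = DIM('a)"
    using dim_eq_card_independent[OF ind[OF B]] by (metis dim_UNIV dim_span)
  moreover obtain l m where "\<forall>b\<in>B. f b = l b *\<^sub>R b" "\<forall>b\<in>B. g b = m b *\<^sub>R b"
    using B unfolding P_def by metis
  ultimately show ?thesis using that[of B l m] B unfolding P_def by blast
qed

lemma orthonormal_basis_parseval:
  fixes B :: "'a::euclidean_space set"
  assumes "finite B" "span B = UNIV" "pairwise orthogonal B" "\<And>b. b \<in> B \<Longrightarrow> norm b = 1"
  shows "x \<bullet> y = (\<Sum>b\<in>B. (x \<bullet> b) * (y \<bullet> b))"
proof -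
  have eq: "(\<Sum>b\<in>B. (b \<bullet> x) *\<^sub>R b) = x"
  proof -
    \<comment> \<open>The remainder of \<open>x\<close> after projection is orthogonal to
      \<open>span B\<close>, which is the whole space, hence to itself.\<close>
    have "orthogonal (x - (\<Sum>b\<in>B. (b \<bullet> x) *\<^sub>R b)) (x - (\<Sum>b\<in>B. (b \<bullet> x) *\<^sub>R b))"
    proof -
      have "(\<Sum>b\<in>B. (b \<bullet> x / (b \<bullet> b)) *\<^sub>R b) = (\<Sum>b\<in>B. (b \<bullet> x) *\<^sub>R b)"
        using assms(4) by (intro sum.cong) (auto simp: dot_square_norm)
      then show ?thesis
        using Gram_Schmidt_step[OF assms(3), of "x - (\<Sum>b\<in>B. (b \<bullet> x) *\<^sub>R b)" x] assms(2)
        by simp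
    qed
    then show ?thesis by (simp add: orthogonal_def)
  qed
  have "x \<bullet> y = (\<Sum>b\<in>B. (b \<bullet> x) *\<^sub>R b) \<bullet> y" by (simp only: eq)
  also have "\<dots> = (\<Sum>b\<in>B. (x \<bullet> b) * (y \<bullet> b))"
    unfolding inner_sum_left by (intro sum.cong) (simp_all add: inner_commute)
  finally show ?thesis .
qed

section \<open>Multiplication operators and atoms of the normalized sequence\<close>

text \<open>The vector \<open>v\<close> stands for v1 + v2 x + v3 y. The columns are the projections
  of x, x^2 and xy to linear polynomials, for instance x^2 to 1 + a0 x + a1 y.\<close>

definition cubic_mult_x :: "(nat \<Rightarrow> real) \<Rightarrow> real^3 \<Rightarrow> real^3" where
  "cubic_mult_x a v =
     vector [v $ 2, v $ 1 + a 0 * v $ 2 + a 1 * v $ 3, a 1 * v $ 2 + a 2 * v $ 3]"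

definition cubic_mult_y :: "(nat \<Rightarrow> real) \<Rightarrow> real^3 \<Rightarrow> real^3" where
  "cubic_mult_y a v =
     vector [v $ 3, a 1 * v $ 2 + a 2 * v $ 3, v $ 1 + a 2 * v $ 2 + a 3 * v $ 3]"

lemma inner_real3: "(x::real^3) \<bullet> y = x $ 1 * y $ 1 + x $ 2 * y $ 2 + x $ 3 * y $ 3"
  by (simp add: inner_vec_def sum_3)

lemma cubic_mult_commute:
  assumes "1 + a 0 * a 2 + a 1 * a 3 = (a 1)\<^sup>2 + (a 2)\<^sup>2"
  shows "cubic_mult_x a (cubic_mult_y a v) = cubic_mult_y a (cubic_mult_x a v)"
proof -
  \<comment> \<open>The commutator maps v to (0, k v3, -k v2), so exactly these two multiples of the
    hypothesis are required.\<close>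
  have "v $ 3 * (1 + a 0 * a 2 + a 1 * a 3) = v $ 3 * ((a 1)\<^sup>2 + (a 2)\<^sup>2)"
    "v $ 2 * (1 + a 0 * a 2 + a 1 * a 3) = v $ 2 * ((a 1)\<^sup>2 + (a 2)\<^sup>2)"
    using assms by simp_all
  then show ?thesis
    by (simp add: cubic_mult_x_def cubic_mult_y_def vec_eq_iff forall_3 algebra_simps
        power2_eq_square)
qed

lemma normalized_cubic_atoms:
  fixes a :: "nat \<Rightarrow> real"
  assumes "1 + a 0 * a 2 + a 1 * a 3 = (a 1)\<^sup>2 + (a 2)\<^sup>2"
  obtains u v \<rho> :: "nat \<Rightarrow> real" where "inj_on (\<lambda>l. (u l, v l)) {1..3}"
    "\<And>l. l \<in> {1..3} \<Longrightarrow> \<rho> l > 0"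
    "(\<Sum>l=1..3. \<rho> l) = 1" "(\<Sum>l=1..3. \<rho> l * u l) = 0" "(\<Sum>l=1..3. \<rho> l * v l) = 0"
    "(\<Sum>l=1..3. \<rho> l * (u l)\<^sup>2) = 1" "(\<Sum>l=1..3. \<rho> l * (u l * v l)) = 0"
    "(\<Sum>l=1..3. \<rho> l * (v l)\<^sup>2) = 1"
    "\<And>i. i \<le> 3 \<Longrightarrow> (\<Sum>l=1..3. \<rho> l * (u l ^ (3 - i) * v l ^ i)) = a i"
proof -
  let ?f = "cubic_mult_x a" and ?g = "cubic_mult_y a"
  have f: "linear ?f" "\<And>x y. ?f x \<bullet> y = x \<bullet> ?f y"
    by (auto intro!: linearI
        simp: cubic_mult_x_def vec_eq_iff forall_3 inner_real3 algebra_simps)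
  have g: "linear ?g" "\<And>x y. ?g x \<bullet> y = x \<bullet> ?g y"
    by (auto intro!: linearI
        simp: cubic_mult_y_def vec_eq_iff forall_3 inner_real3 algebra_simps)
  obtain B p q where B: "finite B" "card B = DIM(real^3)" "span B = UNIV" "pairwise orthogonal B"
    "\<And>b. b \<in> B \<Longrightarrow> norm b = 1"
    and p: "\<And>b. b \<in> B \<Longrightarrow> ?f b = p b *\<^sub>R b" and q: "\<And>b. b \<in> B \<Longrightarrow> ?g b = q b *\<^sub>R b"
    using commuting_selfadjoint_orthonormal_basis[OF f g cubic_mult_commute[OF assms]] by blast
  \<comment> \<open>The first coordinates of the two eigenvector equations read b2 = p b1 and b3 = q
    b1.\<close>
  have coords: "b = b $ 1 *\<^sub>R vector [1, p b, q b]" if "b \<in> B" for b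
    using arg_cong[OF p[OF that], of "\<lambda>v. v $ 1"] arg_cong[OF q[OF that], of "\<lambda>v. v $ 1"]
    by (simp add: cubic_mult_x_def cubic_mult_y_def vec_eq_iff forall_3)
  have b2: "b $ 2 = b $ 1 * p b" and b3: "b $ 3 = b $ 1 * q b" if "b \<in> B" for b
    using arg_cong[OF coords[OF that], of "\<lambda>v. v $ 2"] arg_cong[OF coords[OF that], of "\<lambda>v. v $ 3"]
    by simp_all
  have nz: "b $ 1 \<noteq> 0" if "b \<in> B" for b
    using coords[OF that] B(5)[OF that] by fastforce
  \<comment> \<open>Vectors with the same eigenvalue pair are parallel, whereas distinct members of
    \<open>B\<close> are orthogonal.\<close>
  have inj: "b = c" if "b \<in> B" "c \<in> B" "p b = p c" "q b = q c" for b c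
  proof (rule ccontr)
    assume "b \<noteq> c"
    then have "b \<bullet> c = 0" using B(4) that by (auto simp: pairwise_def orthogonal_def)
    also have "b \<bullet> c = b $ 1 * c $ 1 * (1 + (p b)\<^sup>2 + (q b)\<^sup>2)"
      using that by (simp add: inner_real3 b2 b3 algebra_simps power2_eq_square)
    finally have "1 + (p b)\<^sup>2 + (q b)\<^sup>2 = 0" using nz that by simp
    then show False by (smt (verit) zero_le_power2)
  qed
  obtain h where h: "bij_betw h {1..3::nat} B"
    using ex_bij_betw_nat_finite_1[OF B(1)] B(2) by auto
  then have hB: "h l \<in> B" if "l \<in> {1..3}" for l using that by (auto simp: bij_betw_def)
  have reindex: "(\<Sum>l=1..3. (h l $ 1)\<^sup>2 * F (p (h l)) (q (h l))) = (\<Sum>b\<in>B. (b $ 1)\<^sup>2 * F (p b) (q b))"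
    for F by (rule sum.reindex_bij_betw[OF h])
  have expand: "x \<bullet> y = (\<Sum>b\<in>B. (x \<bullet> b) * (y \<bullet> b))" for x y
    by (rule orthonormal_basis_parseval[OF B(1,3,4)]) (rule B(5))
  have p_inner: "?f x \<bullet> b = p b * (x \<bullet> b)" and q_inner: "?g x \<bullet> b = q b * (x \<bullet> b)" if "b \<in> B" for x b
    using p[OF that] q[OF that] by (simp_all add: f(2) g(2))
  \<comment> \<open>Since x . b is b1 times the linear polynomial of x evaluated at (p b, q b),
    Parseval becomes a quadrature rule with weights b1^2 for products of two linear
    polynomials.\<close>
  have parseval: "x \<bullet> y = (\<Sum>b\<in>B. (b $ 1)\<^sup>2 *
      ((x $ 1 + p b * x $ 2 + q b * x $ 3) * (y $ 1 + p b * y $ 2 + q b * y $ 3)))" for x y :: "real^3"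
    unfolding expand[of x y]
    by (intro sum.cong refl) (simp add: inner_real3 b2 b3 algebra_simps power2_eq_square)
  \<comment> \<open>Applying an operator first contributes one more factor, its eigenvalue, and so
    reaches degree three.\<close>
  have parseval_f: "?f x \<bullet> y = (\<Sum>b\<in>B. (b $ 1)\<^sup>2 *
      (p b * (x $ 1 + p b * x $ 2 + q b * x $ 3) * (y $ 1 + p b * y $ 2 + q b * y $ 3)))" for x y :: "real^3"
    unfolding expand[of "?f x" y]
    by (intro sum.cong refl) (simp only: p_inner, simp add: inner_real3 b2 b3 algebra_simps power2_eq_square)
  have parseval_g: "?g x \<bullet> y = (\<Sum>b\<in>B. (b $ 1)\<^sup>2 *
      (q b * (x $ 1 + p b * x $ 2 + q b * x $ 3) * (y $ 1 + p b * y $ 2 + q b * y $ 3)))" for x y :: "real^3"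
    unfolding expand[of "?g x" y]
    by (intro sum.cong refl) (simp only: q_inner, simp add: inner_real3 b2 b3 algebra_simps power2_eq_square)
  let ?e1 = "vector [1, 0, 0] :: real^3" and ?e2 = "vector [0, 1, 0] :: real^3"
    and ?e3 = "vector [0, 0, 1] :: real^3"
  show ?thesis
  proof (rule that[of "p \<circ> h" "q \<circ> h" "\<lambda>l. (h l $ 1)\<^sup>2"])
    show "inj_on (\<lambda>l. ((p \<circ> h) l, (q \<circ> h) l)) {1..3}"
    proof (rule inj_onI)
      fix l m :: nat assume lm: "l \<in> {1..3}" "m \<in> {1..3}" "((p \<circ> h) l, (q \<circ> h) l) = ((p \<circ> h) m, (q \<circ> h) m)"
      then have "h l = h m" by (intro inj hB) auto
      then show "l = m" using h lm by (auto simp: bij_betw_def inj_on_def)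
    qed
    show "\<And>l. l \<in> {1..3} \<Longrightarrow> (h l $ 1)\<^sup>2 > 0" using nz hB by simp
    show "(\<Sum>l=1..3. (h l $ 1)\<^sup>2) = 1"
      using parseval[of ?e1 ?e1] reindex[of "\<lambda>_ _. 1"] by (simp add: inner_real3)
    show "(\<Sum>l=1..3. (h l $ 1)\<^sup>2 * (p \<circ> h) l) = 0"
      using parseval[of ?e1 ?e2] reindex[of "\<lambda>x _. x"] by (simp add: inner_real3)
    show "(\<Sum>l=1..3. (h l $ 1)\<^sup>2 * (q \<circ> h) l) = 0"
      using parseval[of ?e1 ?e3] reindex[of "\<lambda>_ y. y"] by (simp add: inner_real3)
    show "(\<Sum>l=1..3. (h l $ 1)\<^sup>2 * ((p \<circ> h) l)\<^sup>2) = 1"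
      using parseval[of ?e2 ?e2] reindex[of "\<lambda>x _. x * x"] by (simp add: inner_real3 power2_eq_square)
    show "(\<Sum>l=1..3. (h l $ 1)\<^sup>2 * ((p \<circ> h) l * (q \<circ> h) l)) = 0"
      using parseval[of ?e2 ?e3] reindex[of "\<lambda>x y. x * y"] by (simp add: inner_real3)
    show "(\<Sum>l=1..3. (h l $ 1)\<^sup>2 * ((q \<circ> h) l)\<^sup>2) = 1"
      using parseval[of ?e3 ?e3] reindex[of "\<lambda>_ y. y * y"] by (simp add: inner_real3 power2_eq_square)
    \<comment> \<open>The moments a0, a1, a2 are matrix entries of \<open>?f\<close>; a3 occurs only
      in \<open>?g\<close>.\<close>
    fix i :: nat assume "i \<le> 3"
    then consider "i = 0" | "i = 1" | "i = 2" | "i = 3" by linarith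
    then show "(\<Sum>l=1..3. (h l $ 1)\<^sup>2 * ((p \<circ> h) l ^ (3 - i) * (q \<circ> h) l ^ i)) = a i"
    proof cases
      case 1
      then show ?thesis using parseval_f[of ?e2 ?e2] reindex[of "\<lambda>x y. x * x * x"]
        by (simp add: inner_real3 cubic_mult_x_def power3_eq_cube)
    next
      case 2
      then show ?thesis using parseval_f[of ?e2 ?e3] reindex[of "\<lambda>x y. x * x * y"]
        by (simp add: inner_real3 cubic_mult_x_def power2_eq_square)
    next
      case 3
      then show ?thesis using parseval_f[of ?e3 ?e3] reindex[of "\<lambda>x y. x * y * y"]
        by (simp add: inner_real3 cubic_mult_x_def power2_eq_square algebra_simps)
    next
      case 4
      then show ?thesis using parseval_g[of ?e3 ?e3] reindex[of "\<lambda>x y. y * y * y"]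
        by (simp add: inner_real3 cubic_mult_y_def power3_eq_cube)
    qed
  qed
qed

section \<open>From weighted points to an atomic measure\<close>

text \<open>The measure is a weighted point measure on the index set, pushed forward to the plane.
  Positive weights put every point into the support, and injectivity keeps the count.\<close>

lemma finite_atomic_measure:
  fixes I :: "'i set" and x y \<rho> :: "'i \<Rightarrow> real"
  assumes I: "finite I" and \<rho>: "\<And>l. l \<in> I \<Longrightarrow> \<rho> l > 0" and inj: "inj_on (\<lambda>l. (x l, y l)) I"
    and moments: "\<And>i j. i + j \<le> 3 \<Longrightarrow> \<beta> i j = (\<Sum>l\<in>I. \<rho> l * x l ^ i * y l ^ j)"
  shows "\<exists>\<mu>. representing_measure \<beta> \<mu> \<and> atomic_measure (card I) \<mu>"
proof -
  define z where "z l = (x l, y l)" for l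
  define \<nu> where "\<nu> = point_measure I (\<lambda>l. ennreal (\<rho> l))"
  define \<mu> where "\<mu> = distr \<nu> borel z"
  have meas: "z \<in> measurable \<nu> borel" by (simp add: \<nu>_def measurable_point_measure_eq1)
  have "has_bochner_integral \<mu> (\<lambda>(x, y). x ^ i * y ^ j) (\<beta> i j)" if "i + j \<le> 3" for i j
  proof -
    have [measurable]: "(\<lambda>(x::real, y::real). x ^ i * y ^ j) \<in> borel_measurable borel"
      unfolding case_prod_beta by (intro borel_measurable_continuous_onI continuous_intros)
    have "integrable \<nu> (\<lambda>l. x l ^ i * y l ^ j)"
      unfolding \<nu>_def by (rule integrable_point_measure_finite[OF I])
    moreover have "integral\<^sup>L \<nu> (\<lambda>l. x l ^ i * y l ^ j) = \<beta> i j"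
      unfolding \<nu>_def moments[OF that] using I \<rho>
      by (subst lebesgue_integral_point_measure_finite) (auto simp: less_imp_le intro!: sum.cong)
    ultimately show ?thesis
      unfolding \<mu>_def has_bochner_integral_iff
      by (subst integrable_distr_eq[OF meas], simp, subst integral_distr[OF meas])
        (simp_all add: z_def)
  qed
  then have "representing_measure \<beta> \<mu>" by (simp add: representing_measure_def \<mu>_def)
  moreover have "measure_support \<mu> = z ` I"
  proof -
    have em: "emeasure \<mu> U = (\<Sum>l\<in>{l \<in> I. z l \<in> U}. ennreal (\<rho> l))" if "open U" for U
    proof -
      have "emeasure \<mu> U = emeasure \<nu> (z -` U \<inter> I)"
        unfolding \<mu>_def using that
        by (subst emeasure_distr[OF meas]) (auto simp: \<nu>_def space_point_measure)
      also have "z -` U \<inter> I = {l \<in> I. z l \<in> U}" by auto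
      also have "emeasure \<nu> \<dots> = (\<Sum>l\<in>{l \<in> I. z l \<in> U}. ennreal (\<rho> l))"
        unfolding \<nu>_def using I by (subst emeasure_point_measure_finite) auto
      finally show ?thesis .
    qed
    have "z l \<in> measure_support \<mu>" if "l \<in> I" for l
      unfolding measure_support_def
      using that \<rho> I by (auto simp: em intro!: sum_pos)
    moreover have "p \<notin> measure_support \<mu>" if "p \<notin> z ` I" for p
    proof -
      \<comment> \<open>The finite set of atoms is closed, so its complement is an open null
        neighbourhood of any other point.\<close>
      have op: "open (- z ` I)" using I by (simp add: finite_imp_closed open_Compl)
      moreover have "{l \<in> I. z l \<in> - z ` I} = {}" by blast
      ultimately have "emeasure \<mu> (- z ` I) = 0" by (simp only: em sum.empty)
      with op that show ?thesis unfolding measure_support_def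
        by (auto intro!: exI[of _ "- z ` I"])
    qed
    ultimately show ?thesis by blast
  qed
  ultimately show ?thesis
    using I inj by (auto simp: atomic_measure_def z_def[abs_def] card_image)
qed

section \<open>The Riesz functional under an affine substitution\<close>

lemma riesz_expand:
  "riesz \<beta> p = \<beta> 0 0 * coeff (coeff p 0) 0
     + \<beta> 1 0 * coeff (coeff p 0) 1 + \<beta> 0 1 * coeff (coeff p 1) 0
     + \<beta> 2 0 * coeff (coeff p 0) 2 + \<beta> 1 1 * coeff (coeff p 1) 1 + \<beta> 0 2 * coeff (coeff p 2) 0
     + \<beta> 3 0 * coeff (coeff p 0) 3 + \<beta> 2 1 * coeff (coeff p 1) 2
     + \<beta> 1 2 * coeff (coeff p 2) 1 + \<beta> 0 3 * coeff (coeff p 3) 0"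
proof -
  have "{(i::nat, j). i + j \<le> 3} = Sigma {..3} (\<lambda>i. {..3 - i})" by auto
  then have "riesz \<beta> p = (\<Sum>i\<le>3. \<Sum>j\<le>3 - i. \<beta> i j * coeff (coeff p j) i)"
    unfolding riesz_def by (simp add: sum.Sigma)
  then show ?thesis by (simp add: numeral_3_eq_3 numeral_2_eq_2)
qed

text \<open>Linearity in the moment sequence, here and in \<open>riesz_sum\<close>, allows two
  sequences to be compared through their difference and an atomic one to be split into point
  masses.\<close>

lemma riesz_diff: "riesz (\<lambda>i j. \<beta> i j - \<gamma> i j) p = riesz \<beta> p - riesz \<gamma> p"
  unfolding riesz_expand by (simp add: algebra_simps)

lemma riesz_sum: "riesz (\<lambda>i j. \<Sum>l\<in>I. \<rho> l * \<gamma> l i j) p = (\<Sum>l\<in>I. \<rho> l * riesz (\<gamma> l) p)"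
  unfolding riesz_expand by (simp add: sum.distrib sum_distrib_left sum_distrib_right algebra_simps)

text \<open>\<open>P\<close> and \<open>Q\<close> have the shapes of \<open>Psi1\<close> and
  \<open>Psi2\<close>. The table serves to evaluate at points, to compute the low normalized moments
  and to invert the substitution.\<close>

lemma riesz_affine_powers:
  fixes p0 p1 p2 q0 q1 :: real
  defines "P \<equiv> [:[:p0, p1:], [:p2:]:]" and "Q \<equiv> [:[:q0, q1:]:]"
  shows "riesz \<beta> (P ^ 0 * Q ^ 0) = \<beta> 0 0"
    "riesz \<beta> (P ^ 0 * Q ^ 1) = q0 * \<beta> 0 0 + q1 * \<beta> 1 0"
    "riesz \<beta> (P ^ 1 * Q ^ 0) = p0 * \<beta> 0 0 + p1 * \<beta> 1 0 + p2 * \<beta> 0 1"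
    "riesz \<beta> (P ^ 0 * Q ^ 2) = q0\<^sup>2 * \<beta> 0 0 + 2 * q0 * q1 * \<beta> 1 0 + q1\<^sup>2 * \<beta> 2 0"
    "riesz \<beta> (P ^ 1 * Q ^ 1) = q0 * (p0 * \<beta> 0 0 + p1 * \<beta> 1 0 + p2 * \<beta> 0 1)
       + q1 * (p0 * \<beta> 1 0 + p1 * \<beta> 2 0 + p2 * \<beta> 1 1)"
    "riesz \<beta> (P ^ 2 * Q ^ 0) = p0\<^sup>2 * \<beta> 0 0 + p1\<^sup>2 * \<beta> 2 0 + p2\<^sup>2 * \<beta> 0 2
       + 2 * (p0 * p1 * \<beta> 1 0 + p0 * p2 * \<beta> 0 1 + p1 * p2 * \<beta> 1 1)"
    "riesz \<beta> (P ^ 0 * Q ^ 3) = q0 ^ 3 * \<beta> 0 0 + 3 * q0\<^sup>2 * q1 * \<beta> 1 0 + 3 * q0 * q1\<^sup>2 * \<beta> 2 0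
       + q1 ^ 3 * \<beta> 3 0"
    "riesz \<beta> (P ^ 1 * Q ^ 2) = q0\<^sup>2 * (p0 * \<beta> 0 0 + p1 * \<beta> 1 0 + p2 * \<beta> 0 1)
       + 2 * q0 * q1 * (p0 * \<beta> 1 0 + p1 * \<beta> 2 0 + p2 * \<beta> 1 1)
       + q1\<^sup>2 * (p0 * \<beta> 2 0 + p1 * \<beta> 3 0 + p2 * \<beta> 2 1)"
    "riesz \<beta> (P ^ 2 * Q ^ 1) =
       q0 * (p0\<^sup>2 * \<beta> 0 0 + p1\<^sup>2 * \<beta> 2 0 + p2\<^sup>2 * \<beta> 0 2
         + 2 * (p0 * p1 * \<beta> 1 0 + p0 * p2 * \<beta> 0 1 + p1 * p2 * \<beta> 1 1))
       + q1 * (p0\<^sup>2 * \<beta> 1 0 + p1\<^sup>2 * \<beta> 3 0 + p2\<^sup>2 * \<beta> 1 2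
         + 2 * (p0 * p1 * \<beta> 2 0 + p0 * p2 * \<beta> 1 1 + p1 * p2 * \<beta> 2 1))"
    "riesz \<beta> (P ^ 3 * Q ^ 0) = p0 ^ 3 * \<beta> 0 0 + p1 ^ 3 * \<beta> 3 0 + p2 ^ 3 * \<beta> 0 3
       + 3 * (p0\<^sup>2 * p1 * \<beta> 1 0 + p0\<^sup>2 * p2 * \<beta> 0 1 + p0 * p1\<^sup>2 * \<beta> 2 0
         + p1\<^sup>2 * p2 * \<beta> 2 1 + p0 * p2\<^sup>2 * \<beta> 0 2 + p1 * p2\<^sup>2 * \<beta> 1 2)
       + 6 * p0 * p1 * p2 * \<beta> 1 1"
  unfolding riesz_expand P_def Q_def
  by (simp_all add: numeral_3_eq_3 numeral_2_eq_2) (simp_all add: algebra_simps)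

lemma nat_pairs_le3_cases:
  fixes i j :: nat
  assumes "i + j \<le> 3"
  shows "(i, j) \<in> {(0,0),(0,1),(1,0),(0,2),(1,1),(2,0),(0,3),(1,2),(2,1),(3,0)}"
  using assms by (cases "i = 0"; cases "i = 1"; cases "i = 2"; cases "i = 3"; simp; linarith)

text \<open>The moments of a unit mass at (x, y) turn the functional into evaluation there; the
  degree bound ensures that no monomial is dropped by \<open>riesz\<close>.\<close>

lemma riesz_point_evaluation:
  fixes p0 p1 p2 q0 q1 :: real
  assumes "i + j \<le> 3"
  shows "riesz (\<lambda>i j. x ^ i * y ^ j) ([:[:p0, p1:], [:p2:]:] ^ i * [:[:q0, q1:]:] ^ j)
    = (p0 + p1 * x + p2 * y) ^ i * (q0 + q1 * x) ^ j"
  using nat_pairs_le3_cases[OF assms] riesz_affine_powers[where \<beta> = "\<lambda>i j. x ^ i * y ^ j"]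
  by (elim insertE emptyE Pair_inject; hypsubst)
    (simp_all only:, simp_all add: algebra_simps power2_eq_square power3_eq_cube)

text \<open>The substitution is triangular with diagonal entries made of powers of \<open>p2\<close>
  and \<open>q1\<close>, so the difference of the two sequences can be shown to vanish one moment at
  a time.\<close>

lemma riesz_affine_powers_determine_moments:
  fixes p0 p1 p2 q0 q1 :: real
  assumes nz: "p2 \<noteq> 0" "q1 \<noteq> 0"
    and eq: "\<And>i j. i + j \<le> 3 \<Longrightarrow> riesz \<beta> ([:[:p0, p1:], [:p2:]:] ^ i * [:[:q0, q1:]:] ^ j)
      = riesz \<gamma> ([:[:p0, p1:], [:p2:]:] ^ i * [:[:q0, q1:]:] ^ j)"
    and "i + j \<le> 3"
  shows "\<beta> i j = \<gamma> i j"
proof -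
  define \<delta> where "\<delta> i j = \<beta> i j - \<gamma> i j" for i j
  have "riesz \<delta> ([:[:p0, p1:], [:p2:]:] ^ i * [:[:q0, q1:]:] ^ j) = 0" if "i + j \<le> 3" for i j
    using eq[OF that] unfolding \<delta>_def by (simp add: riesz_diff)
  note zero = this[of 0 0] this[of 0 1] this[of 1 0] this[of 0 2] this[of 1 1] this[of 2 0]
    this[of 0 3] this[of 1 2] this[of 2 1] this[of 3 0]
  note zero = zero[unfolded riesz_affine_powers, simplified]
  \<comment> \<open>The equation for P^i Q^j introduces \<open>\<delta> j i\<close>, with swapped
    indices and coefficient p2^i q1^j; every other moment in it is already known to be zero.\<close>
  have z00: "\<delta> 0 0 = 0" using zero(1) by simp
  have z10: "\<delta> 1 0 = 0" using zero(2) nz by (simp add: z00)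
  have z01: "\<delta> 0 1 = 0" using zero(3) nz z10 by (simp add: z00)
  have z20: "\<delta> 2 0 = 0" using zero(4) nz z10 by (simp add: z00)
  have z11: "\<delta> 1 1 = 0" using zero(5) nz z10 z01 by (simp add: z00 z20)
  have z02: "\<delta> 0 2 = 0" using zero(6) nz z10 z01 z11 by (simp add: z00 z20)
  have z30: "\<delta> 3 0 = 0" using zero(7) nz z10 by (simp add: z00 z20)
  have z21: "\<delta> 2 1 = 0" using zero(8) nz z10 z01 z11 z30 by (simp add: z00 z20 z02)
  have z12: "\<delta> 1 2 = 0" using zero(9) nz z10 z01 z11 z30 z21 by (simp add: z00 z20 z02)
  have z03: "\<delta> 0 3 = 0" using zero(10) nz z10 z01 z11 z30 z21 z12 by (simp add: z00 z20 z02)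
  have "\<delta> i j = 0"
    using nat_pairs_le3_cases[OF \<open>i + j \<le> 3\<close>] z00 z10 z01 z20 z11 z02 z30 z21 z12 z03 by auto
  then show ?thesis by (simp add: \<delta>_def)
qed

section \<open>Positivity of the normalizing constants and the low normalized moments\<close>

text \<open>Positive definiteness says that the functional is positive on (r + s x + t y)^2 for
  nonzero coefficients; two choices of coefficients give \<open>d2\<close> and the product of
  \<open>d2\<close> and \<open>d3\<close>.\<close>

lemma scaled_d2_d3_pos:
  assumes "\<beta> 0 0 > 0" "nonsingular_cubic \<beta>"
  shows "d2 (scaled \<beta>) > 0" "d3 (scaled \<beta>) > 0"
proof -
  define b where "b = scaled \<beta>"
  have b00: "b 0 0 = 1" using assms by (simp add: b_def scaled_def)
  have form: "b 0 0 * r\<^sup>2 + b 2 0 * s\<^sup>2 + b 0 2 * t\<^sup>2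
      + 2 * (b 1 0 * r * s + b 0 1 * r * t + b 1 1 * s * t) > 0"
    if "r \<noteq> 0 \<or> s \<noteq> 0 \<or> t \<noteq> 0" for r s t
  proof -
    let ?v = "vector [r, s, t] :: real^3"
    have "?v \<noteq> 0" using that by (auto simp: vec_eq_iff forall_3)
    then have "?v \<bullet> (moment_matrix \<beta> *v ?v) > 0"
      using assms by (simp add: nonsingular_cubic_def positive_definite_def)
    then have "(?v \<bullet> (moment_matrix \<beta> *v ?v)) / \<beta> 0 0 > 0" using assms by simp
    also have "(?v \<bullet> (moment_matrix \<beta> *v ?v)) / \<beta> 0 0 = b 0 0 * r\<^sup>2 + b 2 0 * s\<^sup>2 + b 0 2 * t\<^sup>2
      + 2 * (b 1 0 * r * s + b 0 1 * r * t + b 1 1 * s * t)"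
      using assms by (simp add: inner_vec_def matrix_vector_mult_def sum_3 moment_matrix_def
          b_def scaled_def field_simps power2_eq_square)
    finally show ?thesis .
  qed
  show d2: "d2 (scaled \<beta>) > 0"
    using form[of "- b 1 0" 1 0] b00 by (simp add: b_def[symmetric] d2_def power2_eq_square)
  \<comment> \<open>These are the coefficients of \<open>Psi1\<close> with its denominator sqrt(d2
    d3) cleared, so the form takes the value d2 d3.\<close>
  have "d2 b * d3 b > 0"
    using form[of "b 0 1 * b 2 0 - b 1 0 * b 1 1" "b 1 1 - b 0 1 * b 1 0" "- d2 b"] d2 b00
    by (simp add: b_def[symmetric])
      (simp add: d2_def d3_def det_3 moment_matrix_def algebra_simps power2_eq_square)
  then show "d3 (scaled \<beta>) > 0" using d2 by (simp add: b_def[symmetric] zero_less_mult_iff)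
qed

text \<open>Up to the sign of \<open>Psi1\<close>, the polynomials 1, \<open>Psi2\<close>,
  \<open>Psi1\<close> arise from 1, x, y by Gram-Schmidt, hence are orthonormal for the
  functional.\<close>

lemma normalization_low_moments:
  assumes "\<beta> 0 0 > 0" "nonsingular_cubic \<beta>"
  shows "normalization \<beta> 0 0 = 1" "normalization \<beta> 0 1 = 0" "normalization \<beta> 1 0 = 0"
    "normalization \<beta> 0 2 = 1" "normalization \<beta> 1 1 = 0" "normalization \<beta> 2 0 = 1"
proof -
  define b where "b = scaled \<beta>"
  have b00: "b 0 0 = 1" using assms by (simp add: b_def scaled_def)
  have pos: "d2 b > 0" "d3 b > 0" using scaled_d2_d3_pos[OF assms] by (simp_all add: b_def)
  \<comment> \<open>With sqrt(d2/d3) rewritten as d2/D, all roots enter through \<open>D\<close> and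
    \<open>s\<close>, and only their squares have to be evaluated.\<close>
  define D where "D = sqrt (d2 b * d3 b)"
  define s where "s = sqrt (d2 b)"
  have D: "D > 0" "D\<^sup>2 = d2 b * d3 b" and s: "s > 0" "s\<^sup>2 = d2 b" using pos by (simp_all add: D_def s_def)
  have "sqrt (d2 b / d3 b) = d2 b / D"
    using pos by (simp add: D_def real_sqrt_divide real_sqrt_mult field_simps)
  then have P: "Psi1 b = [:[:(b 0 1 * b 2 0 - b 1 0 * b 1 1) / D, (b 1 1 - b 0 1 * b 1 0) / D:],
      [:- (d2 b / D):]:]" and Q: "Psi2 b = [:[:- (b 1 0 / s), 1 / s:]:]"
    by (simp_all add: Psi1_def Psi2_def D_def s_def)
  note N = normalization_def[of \<beta>, folded b_def, unfolded P Q]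
  have d3: "d3 b = - b 0 2 * (b 1 0)\<^sup>2 + 2 * b 0 1 * b 1 0 * b 1 1 - (b 1 1)\<^sup>2 - (b 0 1)\<^sup>2 * b 2 0
      + b 0 2 * b 2 0"
    by (simp add: d3_def det_3 moment_matrix_def b00 algebra_simps power2_eq_square)
  have D0: "D \<noteq> 0" and s0: "s \<noteq> 0" using D s by auto
  show "normalization \<beta> 0 0 = 1" unfolding N riesz_affine_powers by (rule b00)
  show "normalization \<beta> 0 1 = 0" unfolding N riesz_affine_powers by (simp add: b00)
  show "normalization \<beta> 1 0 = 0" unfolding N riesz_affine_powers
    using D0 by (simp add: b00 d2_def field_simps power2_eq_square)
  have "normalization \<beta> 0 2 = d2 b / s\<^sup>2" unfolding N riesz_affine_powers
    using s0 by (simp add: b00 d2_def field_simps power2_eq_square)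
  then show "normalization \<beta> 0 2 = 1" using s pos by simp
  show "normalization \<beta> 1 1 = 0" unfolding N riesz_affine_powers
    using s0 D0 by (simp add: b00 d2_def field_simps power2_eq_square)
  have "normalization \<beta> 2 0 = d2 b * d3 b / D\<^sup>2" unfolding N riesz_affine_powers
    using D0 by (simp add: b00 d2_def d3 divide_simps) (simp add: algebra_simps power2_eq_square)
  then show "normalization \<beta> 2 0 = 1" using D pos by simp
qed

section \<open>Transport of the atoms to the original sequence\<close>

theorem theorem3p1:
  fixes \<beta> :: "nat \<Rightarrow> nat \<Rightarrow> real" and a :: "nat \<Rightarrow> real" and k :: real
  assumes "\<beta> 0 0 > 0"
    and "nonsingular_cubic \<beta>"
    and "\<And>i. i \<le> 3 \<Longrightarrow> a i = cubic_moment \<beta> i"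
    and "k = (1 + a 0 * a 2 + a 1 * a 3) - ((a 1)\<^sup>2 + (a 2)\<^sup>2)"
    and "k = 0"
  shows "(\<exists>\<mu>. representing_measure \<beta> \<mu> \<and> atomic_measure 3 \<mu>) \<and>
    (\<exists>(x :: nat \<Rightarrow> real) (y :: nat \<Rightarrow> real) (\<rho> :: nat \<Rightarrow> real).
       inj_on (\<lambda>l. (x l, y l)) {1..3} \<and>
       (\<forall>l \<in> {1..3}. \<rho> l > 0) \<and>
       (\<forall>i j. i + j \<le> 3 \<longrightarrow> \<beta> i j = (\<Sum>l = 1..3. \<rho> l * x l ^ i * y l ^ j)))"
proof -
  define b where "b = scaled \<beta>"
  have "1 + a 0 * a 2 + a 1 * a 3 = (a 1)\<^sup>2 + (a 2)\<^sup>2" using assms(4,5) by simp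
  then obtain u v w :: "nat \<Rightarrow> real" where inj_uv: "inj_on (\<lambda>l. (u l, v l)) {1..3}"
    and w: "\<And>l. l \<in> {1..3} \<Longrightarrow> w l > 0"
    and low: "(\<Sum>l=1..3. w l) = 1" "(\<Sum>l=1..3. w l * u l) = 0" "(\<Sum>l=1..3. w l * v l) = 0"
    "(\<Sum>l=1..3. w l * (u l)\<^sup>2) = 1" "(\<Sum>l=1..3. w l * (u l * v l)) = 0"
    "(\<Sum>l=1..3. w l * (v l)\<^sup>2) = 1"
    and cubic: "\<And>i. i \<le> 3 \<Longrightarrow> (\<Sum>l=1..3. w l * (u l ^ (3 - i) * v l ^ i)) = a i"
    using normalized_cubic_atoms[of a] by blast
  have norm_uv: "normalization \<beta> i j = (\<Sum>l=1..3. w l * (u l ^ i * v l ^ j))" if "i + j \<le> 3" for i j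
  proof (cases "i + j = 3")
    case True
    then have "j \<le> 3" "i = 3 - j" by auto
    then show ?thesis using cubic[of j] assms(3)[of j] by (simp add: cubic_moment_def)
  next
    case False
    then have "(i, j) \<in> {(0,0),(0,1),(1,0),(0,2),(1,1),(2,0)}"
      using nat_pairs_le3_cases[OF that] by auto
    then show ?thesis
      using low normalization_low_moments[OF assms(1,2)] by auto
  qed
  obtain p0 p1 p2 q0 q1 where P: "Psi1 b = [:[:p0, p1:], [:p2:]:]" and Q: "Psi2 b = [:[:q0, q1:]:]"
    and nz: "p2 \<noteq> 0" "q1 \<noteq> 0"
  proof (rule that)
    show "- sqrt (d2 b / d3 b) \<noteq> 0" "1 / sqrt (d2 b) \<noteq> 0"
      using scaled_d2_d3_pos[OF assms(1,2)] by (simp_all add: b_def)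
  qed (rule Psi1_def, rule Psi2_def)
  \<comment> \<open>These atoms solve Psi2 = v for x and then Psi1 = u for y; the factor
    \<open>\<beta> 0 0\<close> in the weights undoes the initial scaling.\<close>
  define x where "x l = (v l - q0) / q1" for l
  define y where "y l = (u l - p0 - p1 * x l) / p2" for l
  define \<rho> where "\<rho> l = \<beta> 0 0 * w l" for l
  have v: "q0 + q1 * x l = v l" and u: "p0 + p1 * x l + p2 * y l = u l" for l
    using nz by (simp_all add: x_def y_def)
  \<comment> \<open>The scaled sequence and the atomic one give the same values to all products of
    powers of \<open>Psi1\<close> and \<open>Psi2\<close>, which determine the moments.\<close>
  have scaled_eq: "b i j = (\<Sum>l=1..3. w l * (x l ^ i * y l ^ j))" if "i + j \<le> 3" for i j
  proof (rule riesz_affine_powers_determine_moments[OF nz _ that])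
    fix i j :: nat assume ij: "i + j \<le> 3"
    show "riesz b ([:[:p0, p1:], [:p2:]:] ^ i * [:[:q0, q1:]:] ^ j)
      = riesz (\<lambda>i j. \<Sum>l=1..3. w l * (x l ^ i * y l ^ j)) ([:[:p0, p1:], [:p2:]:] ^ i * [:[:q0, q1:]:] ^ j)"
      using norm_uv[OF ij]
      unfolding riesz_sum riesz_point_evaluation[OF ij] u v normalization_def b_def[symmetric] P Q .
  qed
  have moments: "\<beta> i j = (\<Sum>l=1..3. \<rho> l * x l ^ i * y l ^ j)" if "i + j \<le> 3" for i j
  proof -
    have "\<beta> i j = \<beta> 0 0 * b i j" using assms(1) by (simp add: b_def scaled_def)
    then show ?thesis
      unfolding scaled_eq[OF that] by (simp add: \<rho>_def sum_distrib_left mult.assoc)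
  qed
  have pos: "\<rho> l > 0" if "l \<in> {1..3}" for l using w[OF that] assms(1) by (simp add: \<rho>_def)
  have inj: "inj_on (\<lambda>l. (x l, y l)) {1..3}"
  proof (rule inj_onI)
    fix l m assume lm: "l \<in> {1..3}" "m \<in> {1..3}" and "(x l, y l) = (x m, y m)"
    then have "x l = x m" "y l = y m" by simp_all
    then have "(u l, v l) = (u m, v m)" using u[of l] u[of m] v[of l] v[of m] by simp
    then show "l = m" using inj_onD[OF inj_uv] lm by blast
  qed
  have "\<exists>\<mu>. representing_measure \<beta> \<mu> \<and> atomic_measure 3 \<mu>"
    using finite_atomic_measure[OF finite_atLeastAtMost pos inj moments] by simp
  with pos inj moments show ?thesis by blast
qed

end
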